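(* Let $N\ge 1$ and let $G$ be a chordal graph that is the union of $N$ cliques $K_{n_1},\dots,K_{n_N}$ (with $n_i$ vertices respectively), such that the intersection of any two of these cliques is a complete graph (possibly empty) and no vertex of $G$ lies in more than two of these cliques. For $i<j$ let $k_{ij}$ be the number of vertices of $K_{n_i}\cap K_{n_j}$. Then \[ M(G)=Z(G)=\sum_{i=1}^N n_i-\sum_{i<j}k_{ij}-N \quad\text{and}\quad \mathrm{mr}(G)=\mathrm{cc}(G)=N. \]
   Context: All graphs are finite, simple and undirected. A graph is chordal if it has no induced cycle of length greater than three. For a graph $G$ on vertex set $\{1,\dots,n\}$, $\mathcal S(G)$ is the set of real symmetric $n\times n$ matrices $A=[a_{ij}]$ such that for $i\ne j$, $a_{ij}\ne 0$ iff $ij\in E(G)$ (diagonal unrestricted); $\mathrm{mr}(G)$ is the minimum rank and $M(G)$ the maximum nullity over $\mathcal S(G)$. The clique cover number $\mathrm{cc}(G)$ is the minimum number of cliques covering all edges of $G$. Zero forcing: vertices are coloured black or white; if a black vertex $u$ has exactly one white neighbour $v$, then $v$ is recoloured black; $Z(G)$ is the minimum size of a set of initially black vertices from which repeated application of this rule colours all vertices black.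
   Formalization: Two hypotheses are added: every clique has at least 2 vertices, and no two of the N cliques have a union that is itself a clique of G; without them the claim fails (K_1 with N=1; K_3 as the union of its three edges), since then cc(G) is at most N-1. *)

theory Defs
  imports "HOL-Analysis.Analysis"
begin

text \<open>
  A finite simple undirected graph is given by its edge set, a set of two-element sets of
  vertices. The vertex set is the whole of a finite type, so that
  \<^typ>\<open>real ^ 'n ^ 'n\<close> is the type of the real matrices indexed by the vertices.
\<close>

definition simple_graph :: "'a set set \<Rightarrow> bool" where
  "simple_graph E \<longleftrightarrow> (\<forall>e\<in>E. card e = 2)"

definition clique :: "'a set set \<Rightarrow> 'a set \<Rightarrow> bool" where
  "clique E K \<longleftrightarrow> (\<forall>u\<in>K. \<forall>v\<in>K. u \<noteq> v \<longrightarrow> {u, v} \<in> E)"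

definition complete_edges :: "'a set \<Rightarrow> 'a set set" where
  "complete_edges K = {e. e \<subseteq> K \<and> card e = 2}"

definition induced_cycle :: "'a set set \<Rightarrow> 'a list \<Rightarrow> bool" where
  "induced_cycle E vs \<longleftrightarrow> length vs \<ge> 3 \<and> distinct vs \<and>
     (\<forall>i j. i < j \<and> j < length vs \<longrightarrow>
        ({vs ! i, vs ! j} \<in> E \<longleftrightarrow> j = Suc i \<or> (i = 0 \<and> j = length vs - 1)))"

definition chordal :: "'a set set \<Rightarrow> bool" where
  "chordal E \<longleftrightarrow> \<not> (\<exists>vs. induced_cycle E vs \<and> length vs > 3)"

definition sym_matrices :: "'n set set \<Rightarrow> (real ^ 'n ^ 'n) set" where
  "sym_matrices E =
     {A. transpose A = A \<and> (\<forall>i j. i \<noteq> j \<longrightarrow> (A $ i $ j \<noteq> 0 \<longleftrightarrow> {i, j} \<in> E))}"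

definition nullity :: "real ^ 'n ^ 'm \<Rightarrow> nat" where
  "nullity A = dim {x. A *v x = 0}"

definition min_rank :: "('n::finite) set set \<Rightarrow> nat" where
  "min_rank E = Min (rank ` sym_matrices E)"

definition max_nullity :: "('n::finite) set set \<Rightarrow> nat" where
  "max_nullity E = Max (nullity ` sym_matrices E)"

definition clique_cover :: "'a set set \<Rightarrow> 'a set set \<Rightarrow> bool" where
  "clique_cover E C \<longleftrightarrow> (\<forall>K\<in>C. clique E K) \<and> (\<forall>e\<in>E. \<exists>K\<in>C. e \<subseteq> K)"

definition clique_cover_number :: "('n::finite) set set \<Rightarrow> nat" where
  "clique_cover_number E = Min (card ` {C. clique_cover E C})"

text \<open>
  The sets \<^term>\<open>B\<close>, \<^term>\<open>B'\<close> are the black vertices before and after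
  one application of the colour change rule.
\<close>

definition force_step :: "'a set set \<Rightarrow> 'a set \<Rightarrow> 'a set \<Rightarrow> bool" where
  "force_step E B B' \<longleftrightarrow>
     (\<exists>u v. u \<in> B \<and> {w. {u, w} \<in> E \<and> w \<notin> B} = {v} \<and> B' = insert v B)"

definition zero_forcing_set :: "'a set set \<Rightarrow> 'a set \<Rightarrow> bool" where
  "zero_forcing_set E B \<longleftrightarrow> (force_step E)\<^sup>*\<^sup>* B UNIV"

definition zero_forcing_number :: "('n::finite) set set \<Rightarrow> nat" where
  "zero_forcing_number E = Min (card ` {B. zero_forcing_set E B})"

end

theory Submission
  imports Defs
begin

text \<open>
  Since every vertex lies in at most two of the cliques, \<open>E\<close> is the line graph of a
  multigraph \<open>H\<close> whose nodes are the cliques; a vertex lying in one clique only is a half-edge.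
  Cycles of length at least four in \<open>H\<close> would be induced cycles of \<open>E\<close>, so by chordality \<open>H\<close> has none.
  The cliques can be ordered so that each \<open>K i\<close> contains two vertices \<open>u \<noteq> v\<close> where \<open>u\<close> lies in no
  later and \<open>v\<close> in no earlier clique: an incomplete order can always be extended by an ear, found
  by following a longest path of \<open>H\<close>; a path without an exit would end in two mergeable cliques.
  Letting the cliques force \<open>u \<rightarrow> v\<close> in this order gives a zero forcing set with \<open>card I\<close> white
  vertices. As a null vector vanishing on a zero forcing set is zero, \<open>M \<le> Z \<le> |V| - N\<close>, whereas
  every clique cover \<open>C\<close> gives a matrix of rank at most \<open>|C|\<close>, so \<open>M \<ge> |V| - cc \<ge> |V| - N\<close>.
\<close>

section \<open>The multigraph of cliques: cycles and longest paths\<close>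

locale clique_family =
  fixes E :: "'a set set" and I :: "'i set" and K :: "'i \<Rightarrow> 'a set"
  assumes finite_I: "finite I"
    and edges: "E = (\<Union>i\<in>I. complete_edges (K i))"
    and chordal_E: "chordal E"
    and at_most_two: "\<lbrakk>i \<in> I; j \<in> I; l \<in> I; x \<in> K i; x \<in> K j; x \<in> K l\<rbrakk> \<Longrightarrow> i = j \<or> i = l \<or> j = l"
    and two_elements: "i \<in> I \<Longrightarrow> \<exists>u\<in>K i. \<exists>v\<in>K i. u \<noteq> v"
    and union_not_clique: "\<lbrakk>i \<in> I; j \<in> I; i \<noteq> j\<rbrakk> \<Longrightarrow> \<not> clique E (K i \<union> K j)"
begin

lemma edge_iff: "u \<noteq> v \<Longrightarrow> {u, v} \<in> E \<longleftrightarrow> (\<exists>i\<in>I. u \<in> K i \<and> v \<in> K i)"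
  unfolding edges complete_edges_def by auto

definition meets :: "'i \<Rightarrow> 'i \<Rightarrow> bool" where
  "meets i j \<longleftrightarrow> K i \<inter> K j \<noteq> {}"

lemma meets_sym: "meets i j \<Longrightarrow> meets j i"
  unfolding meets_def by blast

lemma not_subset: "\<lbrakk>i \<in> I; j \<in> I; i \<noteq> j\<rbrakk> \<Longrightarrow> \<not> K i \<subseteq> K j"
  using union_not_clique[of i j] edge_iff unfolding clique_def by blast

text \<open>Pick a common vertex of any two consecutive cliques of the cycle. By
  \<open>at_most_two\<close> it lies in no third clique, so two picked vertices are adjacent exactly
  when their steps of the cycle share a clique. Four or more of them form an induced cycle.\<close>

lemma no_long_cycle:
  assumes "set p \<subseteq> I" "distinct p" "length p \<ge> 4"
    and cyc: "\<And>t. t < length p \<Longrightarrow> meets (p ! t) (p ! (Suc t mod length p))"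
  shows False
proof -
  define m where "m = length p"
  define nx where "nx t = Suc t mod m" for t
  have m: "m \<ge> 4" using assms(3) m_def by simp
  have nx_less: "nx t < m" for t using m unfolding nx_def by simp
  have nx_eq: "nx t = (if Suc t = m then 0 else Suc t)" if "t < m" for t
    using that unfolding nx_def by auto
  have "\<forall>t. \<exists>x. t < m \<longrightarrow> x \<in> K (p ! t) \<and> x \<in> K (p ! nx t)"
    using cyc unfolding meets_def m_def nx_def by blast
  then obtain e where e: "\<And>t. t < m \<Longrightarrow> e t \<in> K (p ! t) \<and> e t \<in> K (p ! nx t)"
    by metis
  have p_I: "p ! t \<in> I" if "t < m" for t
    using that assms(1) unfolding m_def by (simp add: nth_mem subsetD)
  have p_inj: "p ! s = p ! t \<longleftrightarrow> s = t" if "s < m" "t < m" for s t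
    using that assms(2) unfolding m_def by (simp add: nth_eq_iff_index_eq)
  have mem: "e t \<in> K i \<longleftrightarrow> i = p ! t \<or> i = p ! nx t" if "t < m" "i \<in> I" for t i
  proof
    assume "e t \<in> K i"
    moreover have "t \<noteq> nx t" using nx_eq[OF \<open>t < m\<close>] m by (cases "Suc t = m") auto
    then have "p ! t \<noteq> p ! nx t" using p_inj[OF \<open>t < m\<close> nx_less] by blast
    ultimately show "i = p ! t \<or> i = p ! nx t"
      using at_most_two[OF p_I[OF \<open>t < m\<close>] p_I[OF nx_less] \<open>i \<in> I\<close>] e[OF \<open>t < m\<close>] by blast
  next
    assume "i = p ! t \<or> i = p ! nx t"
    then show "e t \<in> K i" using e[OF \<open>t < m\<close>] by auto
  qed
  \<comment> \<open>Equal picked vertices would have the same two cliques, which happens only in a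
    cycle of length two.\<close>
  have e_inj: "e a \<noteq> e b" if "a < b" "b < m" for a b
  proof
    assume eq: "e a = e b"
    have am: "a < m" using that by simp
    have "p ! a = p ! b \<or> p ! a = p ! nx b"
      using mem[OF \<open>b < m\<close> p_I[OF am]] e[OF am] eq by simp
    then have 1: "a = nx b" using p_inj am that nx_less by auto
    have "p ! b = p ! a \<or> p ! b = p ! nx a"
      using mem[OF am p_I[OF \<open>b < m\<close>]] e[OF \<open>b < m\<close>] eq by simp
    then have 2: "b = nx a" using p_inj am that nx_less by auto
    have "b = Suc a" using 2 nx_eq[OF am] that by (simp split: if_splits)
    moreover have "a = 0 \<and> Suc b = m"
      using 1 nx_eq[OF \<open>b < m\<close>] that by (simp split: if_splits)
    ultimately show False using m by simp
  qed
  have "induced_cycle E (map e [0..<m])"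
    unfolding induced_cycle_def
  proof (intro conjI allI impI)
    show "3 \<le> length (map e [0..<m])" using m by simp
    show "distinct (map e [0..<m])"
      unfolding distinct_map using e_inj by (auto simp: inj_on_def) (metis linorder_neqE_nat)
    fix a b assume "a < b \<and> b < length (map e [0..<m])"
    then have ab: "a < b" "b < m" "a < m" by auto
    have "{e a, e b} \<in> E \<longleftrightarrow> (\<exists>i\<in>I. e a \<in> K i \<and> e b \<in> K i)"
      using edge_iff e_inj ab by blast
    also have "\<dots> \<longleftrightarrow> p ! a = p ! b \<or> p ! a = p ! nx b \<or> p ! nx a = p ! b \<or> p ! nx a = p ! nx b"
      using ab p_I nx_less by (auto simp: mem)
    also have "\<dots> \<longleftrightarrow> a = nx b \<or> nx a = b \<or> nx a = nx b"
      using ab by (auto simp: p_inj nx_less)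
    \<comment> \<open>As a < b, \<open>a = nx b\<close> can only be the wrap-around, and
      \<open>nx a = nx b\<close> never holds.\<close>
    also have "\<dots> \<longleftrightarrow> b = Suc a \<or> (a = 0 \<and> b = m - 1)"
      unfolding nx_eq[OF \<open>a < m\<close>] nx_eq[OF \<open>b < m\<close>] using ab by auto
    finally show "({map e [0..<m] ! a, map e [0..<m] ! b} \<in> E) =
        (b = Suc a \<or> a = 0 \<and> b = length (map e [0..<m]) - 1)"
      using ab by simp
  qed
  then show False using chordal_E m unfolding chordal_def by force
qed

text \<open>The chord closes \<open>take (Suc t) p\<close> to a cycle of t + 1 cliques. Chords at t
  = 2 remain possible, as chordality permits triangles of cliques.\<close>

lemma no_long_chord:
  assumes "set p \<subseteq> I" "distinct p" "successively meets p" "t < length p" "t \<ge> 3"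
  shows "\<not> meets (p ! t) (p ! 0)"
proof
  assume chord: "meets (p ! t) (p ! 0)"
  let ?c = "take (Suc t) p"
  have "meets (?c ! r) (?c ! (Suc r mod length ?c))" if "r < length ?c" for r
  proof (cases "r = t")
    case True
    then show ?thesis using chord assms(4) by simp
  next
    case False
    then show ?thesis
      using that assms(3,4) by (simp add: successively_conv_nth)
  qed
  moreover have "set ?c \<subseteq> I" using assms(1) set_take_subset by fastforce
  ultimately show False
    using no_long_cycle[of ?c] assms by simp
qed

text \<open>The exit vertex \<open>e\<close> is private to the last clique or continues outside \<open>insert s R\<close>.
  A longest path from \<open>s\<close> works, possibly after swapping its last two cliques.\<close>

lemma exit_path:
  assumes "R \<subseteq> I" "s \<in> I" "s \<notin> R" "r \<in> R" "meets r s"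
  obtains q e where "q \<noteq> []" "distinct q" "set q \<subseteq> R" "successively meets (q @ [s])"
    "e \<in> K (hd q)" "\<And>j. j \<in> insert s R - {hd q} \<Longrightarrow> e \<notin> K j"
proof -
  define Q where "Q q \<longleftrightarrow> q \<noteq> [] \<and> distinct q \<and> set q \<subseteq> R \<and> successively meets (q @ [s])" for q
  have "finite R" using assms(1) finite_I finite_subset by blast
  have "Q [r]" using assms unfolding Q_def by simp
  moreover have "\<forall>q. Q q \<longrightarrow> length q < Suc (card R)"
    unfolding Q_def by (metis \<open>finite R\<close> card_mono distinct_card less_Suc_eq_le)
  ultimately obtain q where q: "Q q" and q_max: "\<And>q'. Q q' \<Longrightarrow> length q' \<le> length q"
    using ex_has_greatest_nat[of Q "[r]" length "Suc (card R)"] by blast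
  note found = that
  show thesis
  proof (rule ccontr)
    assume "\<not> thesis"
    then have no_exit: "\<exists>j \<in> insert s R - {hd q'}. e \<in> K j" if "Q q'" "e \<in> K (hd q')" for q' e
      using found[of q' e] that unfolding Q_def by blast
    \<comment> \<open>Another clique through e lies on the path, else prepending it would give a
      longer one; by \<open>no_long_chord\<close> it has position 1 or 2. All paths of maximal
      length are covered because the claim is applied again after a swap.\<close>
    have near: "e \<in> (\<Union>j\<in>set (take 2 (tl (q' @ [s]))). K j)"
      if Q': "Q q'" and len: "length q' = length q" and e: "e \<in> K (hd q')" for q' e
    proof -
      let ?p = "q' @ [s]"
      have p: "set ?p \<subseteq> I" "distinct ?p" "successively meets ?p" "?p ! 0 = hd q'"
        using Q' assms(1-3) unfolding Q_def by (auto simp: nth_append hd_conv_nth)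
      obtain j where j: "j \<in> insert s R" "j \<noteq> hd q'" "e \<in> K j" using no_exit[OF Q' e] by blast
      have "j \<in> set ?p"
      proof (rule ccontr)
        assume j': "j \<notin> set ?p"
        then have "j \<in> R" using j by auto
        moreover have "meets j (hd q')" using j e unfolding meets_def by blast
        ultimately have "Q (j # q')"
          using Q' j' unfolding Q_def by (cases q') auto
        then show False using q_max[of "j # q'"] len by simp
      qed
      then obtain t where t: "t < length ?p" "?p ! t = j" by (meson in_set_conv_nth)
      have "meets (?p ! t) (?p ! 0)" using j e t p(4) unfolding meets_def by auto
      then have "t < 3" using no_long_chord[OF p(1-3) t(1)] by force
      moreover have "t \<noteq> 0" using t j p(4) by metis
      ultimately have "t - 1 < 2" "t - 1 < length (tl ?p)" "Suc (t - 1) = t" using t(1) by auto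
      then have "j \<in> set (take 2 (tl ?p))"
        using t(2) nth_mem[of "t - 1" "take 2 (tl ?p)"]
        by (metis length_take min_less_iff_conj nth_take nth_tl)
      then show ?thesis using j by blast
    qed
    obtain z q' where zq: "q = z # q'" using q unfolding Q_def by (cases q) auto
    have zI: "z \<in> I" "z \<noteq> s" using q zq assms unfolding Q_def by auto
    show False
    proof (cases q')
      case Nil
      then have "K z \<subseteq> K s" using near[OF q refl] zq by auto
      then show False using not_subset[of z s] zI assms by blast
    next
      case (Cons y q'')
      then have yI: "y \<in> I" "y \<noteq> z" using q zq assms unfolding Q_def by auto
      obtain x xs where x: "q'' @ [s] = x # xs" by (cases q'') auto
      have Kz: "K z \<subseteq> K y \<union> K x" using near[OF q refl] zq Cons x by auto
      \<comment> \<open>Since z meets x, the cliques y and z can exchange places, and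
        \<open>near\<close> then also bounds K y.\<close>
      have zx: "meets z x"
        using not_subset[of z y] Kz zI yI unfolding meets_def by blast
      have xI: "x \<in> I" using q zq Cons assms x unfolding Q_def by (cases q'') auto
      have "successively meets (y # z # q'' @ [s])"
        using q zx meets_sym unfolding Q_def zq Cons by (simp add: x)
      then have "Q (y # z # q'')" using q unfolding Q_def zq Cons by auto
      then have Ky: "K y \<subseteq> K z \<union> K x" using near[of "y # z # q''"] zq Cons x by auto
      \<comment> \<open>A vertex of K y outside K z and one of K z outside K y both lie in K x,
        hence are adjacent.\<close>
      have "clique E (K y \<union> K z)"
        unfolding clique_def
      proof (intro ballI impI)
        fix u v assume "u \<in> K y \<union> K z" "v \<in> K y \<union> K z" "u \<noteq> v"
        then show "{u, v} \<in> E" using Kz Ky edge_iff[of u v] xI yI zI by blast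
      qed
      then show False using union_not_clique yI zI by blast
    qed
  qed
qed

section \<open>Ordering the cliques by inserting ears\<close>

text \<open>In the multigraph, u is an edge from i back to A and v a different edge from i on to B;
  a half-edge may serve on either side. This is the local condition under which u can force
  v.\<close>

definition passes :: "'i \<Rightarrow> 'i set \<Rightarrow> 'i set \<Rightarrow> bool" where
  "passes i A B \<longleftrightarrow> (\<exists>u\<in>K i. \<exists>v\<in>K i. u \<noteq> v \<and>
     (\<forall>j\<in>I - {i}. u \<in> K j \<longrightarrow> j \<in> A) \<and> (\<forall>j\<in>I - {i}. v \<in> K j \<longrightarrow> j \<in> B))"

text \<open>In \<open>ordered A L B\<close> the cliques in \<open>A\<close> count as preceding \<open>L\<close> and those in \<open>B\<close> as following it.\<close>

primrec ordered :: "'i set \<Rightarrow> 'i list \<Rightarrow> 'i set \<Rightarrow> bool" where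
  "ordered A [] B \<longleftrightarrow> True"
| "ordered A (i # L) B \<longleftrightarrow> passes i A (set L \<union> B) \<and> ordered (insert i A) L B"

lemma passes_sym: "passes i A B \<Longrightarrow> passes i B A"
  unfolding passes_def by metis

lemma passes_mono: "\<lbrakk>passes i A B; A \<subseteq> A'; B \<subseteq> B'\<rbrakk> \<Longrightarrow> passes i A' B'"
  unfolding passes_def by blast

lemma ordered_mono: "\<lbrakk>ordered A L B; A \<subseteq> A'; B \<subseteq> B'\<rbrakk> \<Longrightarrow> ordered A' L B'"
proof (induction L arbitrary: A A')
  case (Cons i L)
  have "passes i A' (set L \<union> B')"
    using Cons.prems by (auto intro: passes_mono)
  moreover have "ordered (insert i A') L B'"
    using Cons.IH[of "insert i A" "insert i A'"] Cons.prems by auto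
  ultimately show ?case by simp
qed simp

lemma ordered_append:
  "ordered A (L @ M) B \<longleftrightarrow> ordered A L (set M \<union> B) \<and> ordered (A \<union> set L) M B"
  by (induction L arbitrary: A) (auto simp: Un_assoc)

text \<open>Exchanging u and v turns every passage around. Hence only ears whose exit comes before
  their other end have to be inserted.\<close>

lemma ordered_rev: "ordered A L B \<Longrightarrow> ordered B (rev L) A"
proof (induction L arbitrary: A)
  case (Cons i L)
  then have "ordered B (rev L) (insert i A)" "passes i (set L \<union> B) A"
    by (auto intro: passes_sym)
  then show ?case by (simp add: ordered_append Un_commute)
qed simp

text \<open>A vertex shared by two consecutive cliques of the path serves as v for the first and as
  u for the second; the given u and v serve at the two ends.\<close>

lemma ordered_path:
  assumes "p \<noteq> []" "distinct p" "set p \<subseteq> I" "successively meets p"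
    and "set p \<inter> A = {}" "set p \<inter> B = {}" "u \<in> K (hd p)" "v \<in> K (last p)" "u \<noteq> v"
    and "\<And>j. \<lbrakk>j \<in> I - {hd p}; u \<in> K j\<rbrakk> \<Longrightarrow> j \<in> A"
    and "\<And>j. \<lbrakk>j \<in> I - {last p}; v \<in> K j\<rbrakk> \<Longrightarrow> j \<in> B"
  shows "ordered A p B"
  using assms
proof (induction p arbitrary: A u)
  case (Cons i p)
  show ?case
  proof (cases p)
    case Nil
    then have "passes i A B"
      unfolding passes_def using Cons.prems by (intro bexI[of _ u] bexI[of _ v]) auto
    then show ?thesis using Nil by simp
  next
    case (Cons i' p')
    note prems = Cons.prems
    obtain w where w: "w \<in> K i" "w \<in> K i'"
      using prems Cons unfolding meets_def by auto
    have I: "i \<in> I" "i' \<in> I" "i \<noteq> i'" using prems Cons by auto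
    have w_only: "j = i \<or> j = i'" if "j \<in> I" "w \<in> K j" for j
      using at_most_two[OF I(1,2) that(1) w that(2)] I(3) by auto
    \<comment> \<open>Equality would put i' into A, which the path avoids; below, w = v would
      likewise put i into B.\<close>
    have "u \<noteq> w" using prems(10)[of i'] prems(5) w(2) I Cons by auto
    then have "passes i A (set p \<union> B)"
      unfolding passes_def using w w_only prems(7,10) Cons by fastforce
    moreover have "last p \<noteq> i" using prems(2) last_in_set[of p] Cons by auto
    then have "w \<noteq> v" using prems(11)[of i] prems(6) w(1) I Cons by auto
    then have "ordered (insert i A) p B"
      using prems w w_only Cons by (intro Cons.IH[of "insert i A" w]) auto
    ultimately show ?thesis by simp
  qed
qed simp

text \<open>The ear goes directly before s: e is private or comes from \<open>as\<close>, and the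
  last clique of q leads on to s. Cliques already placed keep their passages, since
  \<open>ordered\<close> is monotone in both outer sets.\<close>

lemma insert_path:
  assumes L: "ordered {} (as @ s # bs) {}" "distinct (as @ s # bs)" "set (as @ s # bs) \<subseteq> I"
    and q: "q \<noteq> []" "distinct q" "set q \<subseteq> I - set (as @ s # bs)" "successively meets (q @ [s])"
    and e: "e \<in> K (hd q)" "e \<notin> K s" "\<And>j. \<lbrakk>j \<in> I - {hd q}; e \<in> K j\<rbrakk> \<Longrightarrow> j \<in> set as"
  shows "ordered {} (as @ q @ s # bs) {}"
proof -
  have "meets (last q) s" using q by (simp add: successively_append_iff)
  then obtain v where v: "v \<in> K (last q)" "v \<in> K s" unfolding meets_def by blast
  have lq: "last q \<in> I" "last q \<noteq> s" "s \<in> I"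
    using last_in_set[OF q(1)] subsetD[OF q(3), of "last q"] L(3) by auto
  have "ordered (set as) q (set (s # bs))"
  proof (rule ordered_path[of _ _ _ e v])
    show "j \<in> set (s # bs)" if "j \<in> I - {last q}" "v \<in> K j" for j
      using at_most_two[OF lq(1,3), of j v] that v lq(2) by auto
  qed (use q e v in \<open>auto simp: successively_append_iff\<close>)
  moreover have "ordered {} as (set (q @ s # bs))" "ordered (set as \<union> set q) (s # bs) {}"
    using L(1) ordered_mono by (auto simp: ordered_append simp del: ordered.simps intro: ordered_mono)
  ultimately show ?thesis by (simp add: ordered_append del: ordered.simps)
qed

text \<open>If an unplaced clique meets a placed s, an ear ending at s is inserted. Otherwise a path
  of unplaced cliques whose ends have distinct private vertices is put in front.\<close>

lemma ordered_extend:
  assumes L: "ordered {} L {}" "distinct L" "set L \<subseteq> I" "set L \<noteq> I"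
  shows "\<exists>L'. ordered {} L' {} \<and> distinct L' \<and> set L' \<subseteq> I \<and> length L < length L'"
proof -
  define R where "R = I - set L"
  have R: "R \<subseteq> I" "R \<noteq> {}" using L R_def by auto
  show ?thesis
  proof (cases "\<exists>r\<in>R. \<exists>s\<in>set L. meets r s")
    case True
    then obtain r s where rs: "r \<in> R" "s \<in> set L" "meets r s" by blast
    then have s: "s \<in> I" "s \<notin> R" using L R_def by auto
    obtain q e where q: "q \<noteq> []" "distinct q" "set q \<subseteq> R" "successively meets (q @ [s])"
      and e: "e \<in> K (hd q)" "\<And>j. j \<in> insert s R - {hd q} \<Longrightarrow> e \<notin> K j"
      using exit_path[OF R(1) s rs(1,3)] by metis
    obtain as bs where split: "L = as @ s # bs" using rs(2) split_list by metis
    have hq: "hd q \<in> R" using hd_in_set[OF q(1)] q(3) by blast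
    then have es: "e \<notin> K s" using e(2)[of s] s by auto
    have e': "j \<in> set as \<union> set bs" if "j \<in> I - {hd q}" "e \<in> K j" for j
      using e(2)[of j] that es unfolding R_def split by auto
    \<comment> \<open>Besides \<open>hd q\<close>, at most one clique contains e, and such a clique
      is placed on one side of s.\<close>
    have "(\<forall>j\<in>I - {hd q}. e \<in> K j \<longrightarrow> j \<in> set as) \<or> (\<forall>j\<in>I - {hd q}. e \<in> K j \<longrightarrow> j \<in> set bs)"
    proof (rule ccontr)
      assume "\<not> ?thesis"
      then obtain j j' where j: "j \<in> I - {hd q}" "e \<in> K j" "j \<notin> set as"
        "j' \<in> I - {hd q}" "e \<in> K j'" "j' \<notin> set bs" by blast
      then have "j = j'" using at_most_two[of "hd q" j j' e] hq R e(1) by blast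
      then show False using j e' by blast
    qed
    then show ?thesis
    proof
      assume "\<forall>j\<in>I - {hd q}. e \<in> K j \<longrightarrow> j \<in> set as"
      then have "ordered {} (as @ q @ s # bs) {}"
        using insert_path[of as s bs q e] L(1-3) q e(1) es unfolding split R_def by blast
      moreover have "distinct (as @ q @ s # bs)" "set (as @ q @ s # bs) \<subseteq> I"
        "length L < length (as @ q @ s # bs)"
        using L q unfolding split R_def by auto
      ultimately show ?thesis by blast
    next
      \<comment> \<open>With the exit behind s, the ear is inserted into the reversed order.\<close>
      assume "\<forall>j\<in>I - {hd q}. e \<in> K j \<longrightarrow> j \<in> set bs"
      moreover have "ordered {} (rev bs @ s # rev as) {}"
        using ordered_rev[OF L(1)] unfolding split by simp
      moreover have "distinct (rev bs @ s # rev as)" "set (rev bs @ s # rev as) \<subseteq> I"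
        "set q \<subseteq> I - set (rev bs @ s # rev as)"
        using L q unfolding split R_def by auto
      ultimately have "ordered {} (rev bs @ q @ s # rev as) {}"
        using insert_path[of "rev bs" s "rev as" q e] q e(1) es by (metis set_rev)
      moreover have "distinct (rev bs @ q @ s # rev as)" "set (rev bs @ q @ s # rev as) \<subseteq> I"
        "length L < length (rev bs @ q @ s # rev as)"
        using L q unfolding split R_def by auto
      ultimately show ?thesis by blast
    qed
  next
    case False
    then have apart: "e \<notin> K j" if "e \<in> K i" "i \<in> R" "j \<in> set L" for e i j
      using that unfolding meets_def by blast
    \<comment> \<open>A private vertex for one end: if there were none, some r would meet another
      unplaced clique, and the exit found from r, lying in no clique of L either, would be
      private.\<close>
    have "\<exists>i\<in>R. \<exists>h\<in>K i. \<forall>j\<in>I - {i}. h \<notin> K j"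
    proof (rule ccontr)
      assume none: "\<not> ?thesis"
      obtain r where r: "r \<in> R" using R by blast
      then obtain w where "w \<in> K r" using two_elements R by blast
      then obtain j where j: "j \<in> I - {r}" "w \<in> K j" using none r by blast
      then have "j \<in> R - {r}" using apart \<open>w \<in> K r\<close> r R_def by blast
      moreover have "meets j r" using j \<open>w \<in> K r\<close> unfolding meets_def by blast
      moreover have "R - {r} \<subseteq> I" "r \<in> I" "r \<notin> R - {r}" using r R by auto
      ultimately obtain q e where q: "q \<noteq> []" "set q \<subseteq> R - {r}"
        and e: "e \<in> K (hd q)" "\<And>j. j \<in> insert r (R - {r}) - {hd q} \<Longrightarrow> e \<notin> K j"
        using exit_path[of "R - {r}" r j] by metis
      have "hd q \<in> R" using hd_in_set[OF q(1)] q(2) by blast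
      then have "\<forall>j\<in>I - {hd q}. e \<notin> K j" using e apart[OF e(1)] \<open>hd q \<in> R\<close> R_def by blast
      then show False using none \<open>hd q \<in> R\<close> e(1) by blast
    qed
    then obtain i h where i: "i \<in> R" "i \<in> I" and h: "h \<in> K i" "\<And>j. j \<in> I - {i} \<Longrightarrow> h \<notin> K j"
      using R by blast
    \<comment> \<open>The other end: a path from i to an exit in another clique or, if i meets no
      other unplaced clique, i alone with a second vertex of \<open>K i\<close>.\<close>
    have "\<exists>q e. distinct (q @ [i]) \<and> set (q @ [i]) \<subseteq> R \<and> successively meets (q @ [i]) \<and>
        e \<in> K (hd (q @ [i])) \<and> e \<noteq> h \<and> (\<forall>j\<in>I - {hd (q @ [i])}. e \<notin> K j)"
    proof (cases "\<exists>j\<in>R - {i}. meets j i")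
      case True
      then obtain j where "j \<in> R - {i}" "meets j i" by blast
      moreover have "R - {i} \<subseteq> I" "i \<notin> R - {i}" using R by auto
      ultimately obtain q e where q: "q \<noteq> []" "distinct q" "set q \<subseteq> R - {i}" "successively meets (q @ [i])"
        and e: "e \<in> K (hd q)" "\<And>j. j \<in> insert i (R - {i}) - {hd q} \<Longrightarrow> e \<notin> K j"
        using exit_path[of "R - {i}" i j] i(2) by metis
      have hq: "hd q \<in> R - {i}" using hd_in_set[OF q(1)] q(3) by blast
      then have "\<forall>j\<in>I - {hd q}. e \<notin> K j" using e apart[OF e(1)] hq R_def by blast
      moreover have "e \<noteq> h" using h(1) e(2)[of i] hq by auto
      ultimately show ?thesis using q e i by (intro exI[of _ q] exI[of _ e]) auto
    next
      case no: False
      obtain e where e: "e \<in> K i" "e \<noteq> h" using two_elements[OF i(2)] by metis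
      then have "\<forall>j\<in>I - {i}. e \<notin> K j" using no apart i unfolding R_def meets_def by blast
      then show ?thesis using e i by (intro exI[of _ "[]"] exI[of _ e]) auto
    qed
    then obtain q e where q: "distinct (q @ [i])" "set (q @ [i]) \<subseteq> R" "successively meets (q @ [i])"
      and e: "e \<in> K (hd (q @ [i]))" "e \<noteq> h" "\<forall>j\<in>I - {hd (q @ [i])}. e \<notin> K j"
      by blast
    have "ordered {} (q @ [i]) (set L)"
      by (rule ordered_path[of _ _ _ e h]) (use q e h R in \<open>auto simp: R_def\<close>)
    then have "ordered {} ((q @ [i]) @ L) {}"
      using ordered_mono[OF L(1)] ordered_append[of "{}" "q @ [i]" L "{}"] by simp
    moreover have "distinct ((q @ [i]) @ L)" "set ((q @ [i]) @ L) \<subseteq> I"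
      "length L < length ((q @ [i]) @ L)"
      using L q unfolding R_def by auto
    ultimately show ?thesis by blast
  qed
qed

lemma ordering_exists: "\<exists>L. ordered {} L {} \<and> distinct L \<and> set L = I"
proof -
  define P where "P L \<longleftrightarrow> ordered {} L {} \<and> distinct L \<and> set L \<subseteq> I" for L
  have "P []" unfolding P_def by simp
  moreover have "\<forall>L. P L \<longrightarrow> length L < Suc (card I)"
    unfolding P_def by (metis finite_I card_mono distinct_card less_Suc_eq_le)
  ultimately obtain L where L: "P L" and "\<And>L'. P L' \<Longrightarrow> length L' \<le> length L"
    using ex_has_greatest_nat[of P "[]" length "Suc (card I)"] by blast
  then have "set L = I" using ordered_extend[of L] unfolding P_def by (meson leD)
  then show ?thesis using L P_def by blast
qed

section \<open>From an ordering to a zero forcing set\<close>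

text \<open>W collects the vertices v of the cliques in L, which force in list order. When i forces,
  the white vertices other than v avoid \<open>K i\<close> and all cliques of A, whereas u lies in
  no further clique; so v is its only white neighbour.\<close>

lemma forcing_of_ordered:
  assumes "ordered A L {}" "distinct L" "set L \<inter> A = {}" "A \<union> set L = I"
  shows "\<exists>W. finite W \<and> card W = length L \<and> (\<forall>a\<in>A. W \<inter> K a = {}) \<and> zero_forcing_set E (- W)"
  using assms
proof (induction L arbitrary: A)
  case Nil
  show ?case by (rule exI[of _ "{}"]) (simp add: zero_forcing_set_def)
next
  case (Cons i L)
  then obtain W where W: "finite W" "card W = length L" "W \<inter> K i = {}" "\<forall>a\<in>A. W \<inter> K a = {}"
    and forces: "zero_forcing_set E (- W)"
    using Cons.IH[of "insert i A"] by auto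
  obtain u v where uv: "u \<in> K i" "v \<in> K i" "u \<noteq> v"
    "\<forall>j\<in>I - {i}. u \<in> K j \<longrightarrow> j \<in> A" "\<forall>j\<in>I - {i}. v \<in> K j \<longrightarrow> j \<in> set L"
    using Cons.prems(1) unfolding ordered.simps passes_def Un_empty_right by metis
  have iI: "i \<in> I" using Cons.prems by auto
  have vW: "v \<notin> W" "u \<notin> W" using uv W by auto
  have "{w. {u, w} \<in> E \<and> w \<notin> - insert v W} = {v}"
  proof
    show "{v} \<subseteq> {w. {u, w} \<in> E \<and> w \<notin> - insert v W}"
      using edge_iff[of u v] uv iI by auto
    show "{w. {u, w} \<in> E \<and> w \<notin> - insert v W} \<subseteq> {v}"
    proof
      fix w assume w: "w \<in> {w. {u, w} \<in> E \<and> w \<notin> - insert v W}"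
      show "w \<in> {v}"
      proof (rule ccontr)
        assume "w \<notin> {v}"
        then have "w \<in> W" "u \<noteq> w" using w vW by auto
        then obtain j where j: "j \<in> I" "u \<in> K j" "w \<in> K j" using w edge_iff by blast
        then have "j = i \<or> j \<in> A" using uv by blast
        then show False using W j \<open>w \<in> W\<close> by blast
      qed
    qed
  qed
  moreover have "- W = insert v (- insert v W)" using vW by auto
  ultimately have "force_step E (- insert v W) (- W)"
    unfolding force_step_def using uv vW by (intro exI[of _ u] exI[of _ v]) auto
  then have "zero_forcing_set E (- insert v W)"
    using forces unfolding zero_forcing_set_def by (rule converse_rtranclp_into_rtranclp)
  \<comment> \<open>The invariant persists: apart from i, only cliques of L contain v, and none of
    them belongs to A.\<close>
  moreover have "v \<notin> K a" if "a \<in> A" for a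
  proof -
    have "a \<in> I - {i}" "a \<notin> set L" using that Cons.prems(3,4) by auto
    then show ?thesis using uv(5) by blast
  qed
  ultimately show ?case using W vW by (intro exI[of _ "insert v W"]) auto
qed

lemma zero_forcing_complement:
  "\<exists>W. finite W \<and> card W = card I \<and> zero_forcing_set E (- W)"
  using ordering_exists forcing_of_ordered[of "{}"] by (metis distinct_card ball_empty inf_bot_right sup_bot_left)

end

section \<open>Nullity bounds from zero forcing and clique covers\<close>

text \<open>The kernel is the orthogonal complement of the row space.\<close>

lemma rank_plus_nullity: "rank A + nullity A = CARD('n)" for A :: "real ^ 'n ^ 'n"
proof -
  have "{x. A *v x = 0} = {y \<in> UNIV. \<forall>x\<in>span (rows A). orthogonal x y}" (is "?L = ?R")
  proof
    show "?L \<subseteq> ?R" by (auto intro: orthogonal_nullspace_rowspace simp: orthogonal_commute)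
    show "?R \<subseteq> ?L"
    proof
      fix y assume y: "y \<in> ?R"
      have "row i A \<bullet> y = 0" for i
        using y span_base[of "row i A" "rows A"] unfolding rows_def orthogonal_def by blast
      then show "y \<in> ?L" by (simp add: vec_eq_iff matrix_vector_mul_component row_def)
    qed
  qed
  then show ?thesis
    using dim_subspace_orthogonal_to_vectors[of "span (rows A)" UNIV]
    by (simp add: nullity_def row_rank_def)
qed

text \<open>Whenever u forces v, row u of \<open>A *v x = 0\<close> reduces to the term of v. So a
  null vector vanishing on B is zero, and restriction to B is injective on the kernel.\<close>

lemma nullity_le_zero_forcing:
  fixes A :: "real ^ 'n ^ 'n"
  assumes A: "A \<in> sym_matrices E" and B: "zero_forcing_set E B"
  shows "nullity A \<le> card B"
proof -
  let ?N = "{x. A *v x = 0}"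
  define f :: "real ^ 'n \<Rightarrow> real ^ 'n" where "f x = (\<chi> i. if i \<in> B then x $ i else 0)" for x
  have entry: "A $ i $ j \<noteq> 0 \<longleftrightarrow> {i, j} \<in> E" if "i \<noteq> j" for i j
    using A that by (simp add: sym_matrices_def)
  have vanish: "x = 0" if "A *v x = 0" "\<forall>i\<in>B. x $ i = 0" for x
  proof -
    have "(force_step E)\<^sup>*\<^sup>* B UNIV" using B unfolding zero_forcing_set_def .
    then have "\<forall>i\<in>UNIV. x $ i = 0"
    proof (induction rule: rtranclp_induct)
      case base
      then show ?case using that by blast
    next
      case (step C C')
      then obtain u v where uv: "u \<in> C" "{w. {u, w} \<in> E \<and> w \<notin> C} = {v}" "C' = insert v C"
        unfolding force_step_def by blast
      have v: "{u, v} \<in> E" "v \<notin> C" using uv by blast+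
      \<comment> \<open>The term j = u falls under the black case, so the free diagonal entry does
        no harm.\<close>
      have other: "A $ u $ j * x $ j = 0" if "j \<noteq> v" for j
      proof (cases "j \<in> C")
        case False
        then have "{u, j} \<notin> E" "u \<noteq> j" using uv that by blast+
        then have "A $ u $ j = 0" using entry by blast
        then show ?thesis by simp
      qed (use step.IH in simp)
      have "0 = (\<Sum>j\<in>UNIV. A $ u $ j * x $ j)"
        using \<open>A *v x = 0\<close> by (simp add: matrix_vector_mult_def vec_eq_iff)
      also have "\<dots> = (\<Sum>j\<in>{v}. A $ u $ j * x $ j)"
        by (rule sum.mono_neutral_right) (use other in auto)
      finally have "A $ u $ v * x $ v = 0" by simp
      moreover have "u \<noteq> v" using v(2) uv(1) by blast
      then have "A $ u $ v \<noteq> 0" using entry v(1) by blast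
      ultimately show ?case using uv step.IH by simp
    qed
    then show ?thesis by (simp add: vec_eq_iff)
  qed
  have f: "linear f" unfolding f_def by (rule linearI) (auto simp: vec_eq_iff)
  have sub: "subspace ?N"
    by (auto simp: subspace_def matrix_vector_right_distrib matrix_vector_mult_scaleR)
  have inj: "inj_on f ?N"
  proof (rule inj_onI)
    fix x y assume xy: "x \<in> ?N" "y \<in> ?N" "f x = f y"
    have "A *v (x - y) = 0" using xy by (simp add: matrix_vector_mult_diff_distrib)
    moreover have "(x - y) $ i = 0" if "i \<in> B" for i
      using arg_cong[OF xy(3), of "\<lambda>z. z $ i"] that by (simp add: f_def)
    ultimately show "x = y" using vanish[of "x - y"] by simp
  qed
  have "nullity A = dim (f ` ?N)"
    unfolding nullity_def using dim_image_eq[OF f, of ?N] inj sub by (simp add: span_eq_iff[THEN iffD2])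
  also have "\<dots> \<le> dim {x :: real ^ 'n. \<forall>i. i \<notin> B \<longrightarrow> x $ i = 0}"
    by (rule dim_subset) (auto simp: f_def)
  also have "\<dots> = card B"
    using dim_substandard_cart[of B, where 'a = real] by (simp add: dim_vec_eq)
  finally show ?thesis .
qed

text \<open>Take the sum of the outer products of the indicator vectors of the cliques with
  themselves. Its entries are counts, so nothing cancels, and its columns lie in the span of these
  indicators.\<close>

lemma clique_cover_matrix:
  fixes E :: "('n::finite) set set"
  assumes C: "clique_cover E C"
  obtains A where "A \<in> sym_matrices E" "rank A \<le> card C"
proof
  define ind :: "'n set \<Rightarrow> real ^ 'n" where "ind K = (\<chi> i. if i \<in> K then 1 else 0)" for K
  define A :: "real ^ 'n ^ 'n" where "A = (\<chi> i j. real (card {K \<in> C. i \<in> K \<and> j \<in> K}))"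
  have "(A $ i $ j \<noteq> 0) = ({i, j} \<in> E)" if "i \<noteq> j" for i j
  proof -
    have "(A $ i $ j \<noteq> 0) \<longleftrightarrow> (\<exists>K\<in>C. i \<in> K \<and> j \<in> K)" by (auto simp: A_def)
    also have "\<dots> \<longleftrightarrow> {i, j} \<in> E"
    proof
      assume "\<exists>K\<in>C. i \<in> K \<and> j \<in> K"
      then show "{i, j} \<in> E" using C that unfolding clique_cover_def clique_def by blast
    next
      assume "{i, j} \<in> E"
      then obtain K where "K \<in> C" "{i, j} \<subseteq> K" using C unfolding clique_cover_def by blast
      then show "\<exists>K\<in>C. i \<in> K \<and> j \<in> K" by blast
    qed
    finally show ?thesis .
  qed
  moreover have "transpose A = A"
    by (simp add: transpose_def A_def vec_eq_iff conj_commute)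
  ultimately show "A \<in> sym_matrices E" unfolding sym_matrices_def by blast
  have "column j A = (\<Sum>K\<in>{K \<in> C. j \<in> K}. ind K)" for j
  proof -
    have "real (card {K \<in> C. i \<in> K \<and> j \<in> K}) = (\<Sum>K\<in>{K \<in> C. j \<in> K}. if i \<in> K then 1 else 0)" for i
      by (subst sum.inter_filter[symmetric]) (auto intro!: arg_cong[where f = card])
    then show ?thesis by (simp add: vec_eq_iff column_def A_def ind_def)
  qed
  moreover have "(\<Sum>K\<in>{K \<in> C. j \<in> K}. ind K) \<in> span (ind ` C)" for j
    by (rule span_sum) (simp add: span_base)
  ultimately have "columns A \<subseteq> span (ind ` C)" unfolding columns_def by auto
  then have "dim (columns A) \<le> card (ind ` C)" by (rule dim_le_card) simp
  also have "\<dots> \<le> card C" by (rule card_image_le) simp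
  finally show "rank A \<le> card C" by (simp add: column_rank_def)
qed

section \<open>Counting vertices, and the resulting equalities\<close>

text \<open>Inclusion-exclusion at one vertex, with D the set of cliques through it: d = 1 + (d
  choose 2) for d = 1 and d = 2.\<close>

lemma card_ordered_pairs:
  fixes D :: "'a::linorder set"
  assumes "card D = 1 \<or> card D = 2"
  shows "card D = Suc (card {(i, j). i \<in> D \<and> j \<in> D \<and> i < j})"
  using assms
proof
  assume "card D = 1"
  then obtain a where "D = {a}" using card_1_singletonE by blast
  then have "{(i, j). i \<in> D \<and> j \<in> D \<and> i < j} = {}" by auto
  then show ?thesis using \<open>card D = 1\<close> by (metis One_nat_def card.empty)
next
  assume "card D = 2"
  then obtain x y where "D = {x, y}" "x \<noteq> y" unfolding card_2_iff by blast
  then obtain a b where "D = {a, b}" "a < b" using linorder_neqE[of x y] by (metis insert_commute)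
  then have "{(i, j). i \<in> D \<and> j \<in> D \<and> i < j} = {(a, b)}" by auto
  then have "card {(i, j). i \<in> D \<and> j \<in> D \<and> i < j} = 1" by (metis is_singletonI is_singleton_altdef)
  then show ?thesis using \<open>card D = 2\<close> by linarith
qed

text \<open>The preceding identity is summed over all vertices; double counting turns both sides
  into sums over cliques and over pairs of cliques.\<close>

lemma sum_card_eq_card_Union:
  fixes I :: "'i::linorder set" and K :: "'i \<Rightarrow> 'a::finite set"
  assumes "finite I" "(\<Union>i\<in>I. K i) = UNIV" "\<And>v. card {i \<in> I. v \<in> K i} \<le> 2"
  shows "(\<Sum>i\<in>I. card (K i)) =
    CARD('a) + (\<Sum>(i, j)\<in>{(i, j). i \<in> I \<and> j \<in> I \<and> i < j}. card (K i \<inter> K j))"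
proof -
  let ?P = "{(i, j). i \<in> I \<and> j \<in> I \<and> i < j}"
  let ?D = "\<lambda>v. {i \<in> I. v \<in> K i}"
  have finP: "finite ?P" by (rule finite_subset[of _ "I \<times> I"]) (use assms(1) in auto)
  have "card (?D v) = Suc (card {(i, j). i \<in> ?D v \<and> j \<in> ?D v \<and> i < j})" for v
  proof (rule card_ordered_pairs)
    have "?D v \<noteq> {}" using assms(2) by blast
    then have "card (?D v) \<noteq> 0" using assms(1) by simp
    then show "card (?D v) = 1 \<or> card (?D v) = 2" using assms(3)[of v] by linarith
  qed
  moreover have "{(i, j). i \<in> ?D v \<and> j \<in> ?D v \<and> i < j} = {p \<in> ?P. v \<in> K (fst p) \<inter> K (snd p)}" for v
    by auto
  ultimately have D: "card (?D v) = Suc (card {p \<in> ?P. v \<in> K (fst p) \<inter> K (snd p)})" for v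
    by simp
  have count: "(\<Sum>i\<in>J. card (F i)) = (\<Sum>v\<in>UNIV. card {i \<in> J. v \<in> F i})"
    if "finite J" for J :: "'j set" and F :: "'j \<Rightarrow> 'a set"
  proof -
    have "(\<Sum>i\<in>J. card (F i)) = (\<Sum>i\<in>J. \<Sum>v\<in>UNIV. if v \<in> F i then 1 else 0)"
      by (simp add: sum.If_cases)
    also have "\<dots> = (\<Sum>v\<in>UNIV. \<Sum>i\<in>J. if v \<in> F i then 1 else 0)" by (rule sum.swap)
    also have "\<dots> = (\<Sum>v\<in>UNIV. card {i \<in> J. v \<in> F i})"
      using that by (simp add: sum.If_cases Int_def)
    finally show ?thesis .
  qed
  have "(\<Sum>i\<in>I. card (K i)) = (\<Sum>v\<in>UNIV. card (?D v))" using count assms(1) by blast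
  also have "\<dots> = CARD('a) + (\<Sum>v\<in>UNIV. card {p \<in> ?P. v \<in> K (fst p) \<inter> K (snd p)})"
    unfolding D by (simp only: Suc_eq_plus1_left sum.distrib) simp
  also have "(\<Sum>v\<in>UNIV. card {p \<in> ?P. v \<in> K (fst p) \<inter> K (snd p)}) =
      (\<Sum>p\<in>?P. card (K (fst p) \<inter> K (snd p)))"
    using count[OF finP, of "\<lambda>p. K (fst p) \<inter> K (snd p)"] by simp
  finally show ?thesis by (simp add: case_prod_beta)
qed

text \<open>\<open>nontrivial\<close> and \<open>not_mergeable\<close> exclude degenerate
  decompositions: for a lone vertex with N = 1 the formula gives 0 while M = 1, and for a triangle
  split into its three edges it gives 0 while M = 2.\<close>

theorem theorem4p24:
  fixes E :: "('n::finite) set set"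
    and N :: nat
    and K :: "nat \<Rightarrow> 'n set"
    and n :: "nat \<Rightarrow> nat"
    and k :: "nat \<Rightarrow> nat \<Rightarrow> nat"
  assumes "simple_graph E" and "chordal E"
    and "N \<ge> 1"
    and "\<And>i. i \<in> {1..N} \<Longrightarrow> clique E (K i)"
    and "(\<Union>i\<in>{1..N}. K i) = UNIV"
    and "(\<Union>i\<in>{1..N}. complete_edges (K i)) = E"
    and "\<And>i j. i \<in> {1..N} \<Longrightarrow> j \<in> {1..N} \<Longrightarrow> i \<noteq> j \<Longrightarrow>
           complete_edges (K i) \<inter> complete_edges (K j) = complete_edges (K i \<inter> K j)"
    and "\<And>v. card {i \<in> {1..N}. v \<in> K i} \<le> 2"
    and "\<And>i. i \<in> {1..N} \<Longrightarrow> n i = card (K i)"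
    and "\<And>i j. i \<in> {1..N} \<Longrightarrow> j \<in> {1..N} \<Longrightarrow> i < j \<Longrightarrow> k i j = card (K i \<inter> K j)"
    and nontrivial: "\<And>i. i \<in> {1..N} \<Longrightarrow> n i \<ge> 2"
    and not_mergeable: "\<And>i j. i \<in> {1..N} \<Longrightarrow> j \<in> {1..N} \<Longrightarrow> i < j \<Longrightarrow> \<not> clique E (K i \<union> K j)"
  shows "int (max_nullity E) =
           (\<Sum>i\<in>{1..N}. int (n i)) - (\<Sum>(i, j)\<in>{(i, j). 1 \<le> i \<and> i < j \<and> j \<le> N}. int (k i j)) - int N
         \<and> zero_forcing_number E = max_nullity E
         \<and> min_rank E = N
         \<and> clique_cover_number E = N"
proof -
  let ?V = "CARD('n)"
  interpret clique_family E "{1..N}" K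
  proof
    show "finite {1..N}" by simp
    show "E = (\<Union>i\<in>{1..N}. complete_edges (K i))" using assms(6) by simp
    show "chordal E" by fact
    show "i = j \<or> i = l \<or> j = l"
      if "i \<in> {1..N}" "j \<in> {1..N}" "l \<in> {1..N}" "x \<in> K i" "x \<in> K j" "x \<in> K l" for i j l x
    proof (rule ccontr)
      assume "\<not> ?thesis"
      then have "card {i, j, l} = 3" by simp
      moreover have "card {i, j, l} \<le> card {i \<in> {1..N}. x \<in> K i}"
        by (rule card_mono) (use that in auto)
      ultimately show False using assms(8)[of x] by simp
    qed
    show "\<exists>u\<in>K i. \<exists>v\<in>K i. u \<noteq> v" if "i \<in> {1..N}" for i
    proof (rule ccontr)
      assume "\<not> ?thesis"
      then have "card (K i) \<le> Suc 0" by (subst card_le_Suc0_iff_eq) auto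
      then show False using nontrivial[OF that] assms(9)[OF that] by simp
    qed
    show "\<not> clique E (K i \<union> K j)" if "i \<in> {1..N}" "j \<in> {1..N}" "i \<noteq> j" for i j
      using not_mergeable[of i j] not_mergeable[of j i] that by (metis Un_commute linorder_neqE_nat)
  qed
  obtain W :: "'n set" where W: "card W = N" "zero_forcing_set E (- W)"
    using zero_forcing_complement by auto
  \<comment> \<open>This keeps the truncated subtraction \<open>?V - N\<close> exact.\<close>
  have "N \<le> ?V" using W(1) card_mono[of UNIV W] by simp
  have "zero_forcing_number E \<le> card (- W)"
    unfolding zero_forcing_number_def by (rule Min_le) (use W in auto)
  then have Z_le: "zero_forcing_number E \<le> ?V - N"
    using W(1) by (simp add: Compl_eq_Diff_UNIV card_Diff_subset)
  have "zero_forcing_number E \<in> card ` {B. zero_forcing_set E B}"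
    unfolding zero_forcing_number_def by (rule Min_in) (use W in auto)
  then obtain B where B: "zero_forcing_set E B" "card B = zero_forcing_number E" by auto

  have cover: "clique_cover E (K ` {1..N})"
    unfolding clique_cover_def
  proof (intro conjI ballI)
    show "clique E L" if "L \<in> K ` {1..N}" for L using that assms(4) by auto
    show "\<exists>L\<in>K ` {1..N}. e \<subseteq> L" if "e \<in> E" for e
      using that assms(6) unfolding complete_edges_def by blast
  qed
  have "clique_cover_number E \<le> card (K ` {1..N})"
    unfolding clique_cover_number_def by (rule Min_le) (use cover in auto)
  also have "\<dots> \<le> N" using card_image_le[of "{1..N}" K] by simp
  finally have cc_le: "clique_cover_number E \<le> N" .
  have "clique_cover_number E \<in> card ` {C. clique_cover E C}"
    unfolding clique_cover_number_def by (rule Min_in) (use cover in auto)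
  then obtain C where C: "clique_cover E C" "card C = clique_cover_number E" by auto
  obtain A where A: "A \<in> sym_matrices E" "rank A \<le> clique_cover_number E"
    using clique_cover_matrix[OF C(1)] C(2) by metis

  \<comment> \<open>\<open>sym_matrices E\<close> is infinite; these bounds make its sets of ranks
    and nullities finite, so that \<open>Min\<close> and \<open>Max\<close> are attained.\<close>
  have bounds: "nullity A' \<le> ?V" "rank A' \<le> ?V" for A' :: "real ^ 'n ^ 'n"
    using rank_plus_nullity[of A'] by linarith+
  have finite_nullity: "finite (nullity ` sym_matrices E)"
    by (rule finite_subset[of _ "{..?V}"]) (use bounds in auto)
  have finite_rank: "finite (rank ` sym_matrices E)"
    by (rule finite_subset[of _ "{..?V}"]) (use bounds in auto)
  have nullity_le: "nullity A' \<le> max_nullity E" if "A' \<in> sym_matrices E" for A'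
    unfolding max_nullity_def using finite_nullity that by simp
  have "max_nullity E \<in> nullity ` sym_matrices E"
    unfolding max_nullity_def by (rule Max_in) (use finite_nullity A in auto)
  then obtain A0 where A0: "A0 \<in> sym_matrices E" "nullity A0 = max_nullity E" by auto
  have M_le: "max_nullity E \<le> zero_forcing_number E"
    using nullity_le_zero_forcing[OF A0(1) B(1)] A0(2) B(2) by simp
  have "?V \<le> clique_cover_number E + max_nullity E"
    using rank_plus_nullity[of A] A(2) nullity_le[OF A(1)] by linarith
  \<comment> \<open>The chain |V| - cc <= M <= Z <= |V| - N together with cc <= N forces equality
    throughout.\<close>
  then have eqs: "max_nullity E + N = ?V" "zero_forcing_number E = max_nullity E"
    "clique_cover_number E = N"
    using M_le Z_le cc_le \<open>N \<le> ?V\<close> by linarith+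
  have "min_rank E = N"
    unfolding min_rank_def
  proof (rule Min_eqI)
    show "N \<le> r" if r: "r \<in> rank ` sym_matrices E" for r
    proof -
      obtain A' where "A' \<in> sym_matrices E" "r = rank A'" using r by blast
      then show ?thesis using nullity_le[of A'] rank_plus_nullity[of A'] eqs(1) by linarith
    qed
    have "N = rank A0" using rank_plus_nullity[of A0] A0(2) eqs(1) by linarith
    then show "N \<in> rank ` sym_matrices E" using A0(1) by blast
  qed (rule finite_rank)
  moreover have "int (max_nullity E) = (\<Sum>i\<in>{1..N}. int (n i)) -
      (\<Sum>(i, j)\<in>{(i, j). 1 \<le> i \<and> i < j \<and> j \<le> N}. int (k i j)) - int N"
  proof -
    have pairs: "{(i, j). 1 \<le> i \<and> i < j \<and> j \<le> N} = {(i, j). i \<in> {1..N} \<and> j \<in> {1..N} \<and> i < j}"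
      by auto
    have "(\<Sum>i\<in>{1..N}. n i) = (\<Sum>i\<in>{1..N}. card (K i))" using assms(9) by simp
    also have "\<dots> = ?V + (\<Sum>(i, j)\<in>{(i, j). i \<in> {1..N} \<and> j \<in> {1..N} \<and> i < j}. card (K i \<inter> K j))"
      using sum_card_eq_card_Union[of "{1..N}" K] assms(5,8) by simp
    also have "(\<Sum>(i, j)\<in>{(i, j). i \<in> {1..N} \<and> j \<in> {1..N} \<and> i < j}. card (K i \<inter> K j)) =
        (\<Sum>(i, j)\<in>{(i, j). 1 \<le> i \<and> i < j \<and> j \<le> N}. k i j)"
      unfolding pairs by (rule sum.cong) (use assms(10) in auto)
    finally have "(\<Sum>i\<in>{1..N}. n i) =
        max_nullity E + N + (\<Sum>(i, j)\<in>{(i, j). 1 \<le> i \<and> i < j \<and> j \<le> N}. k i j)"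
      using eqs(1) by simp
    then have "int (\<Sum>i\<in>{1..N}. n i) = int (max_nullity E) + int N +
        int (\<Sum>(i, j)\<in>{(i, j). 1 \<le> i \<and> i < j \<and> j \<le> N}. k i j)"
      by simp
    then show ?thesis by (simp add: case_prod_beta)
  qed
  ultimately show ?thesis using eqs by simp
qed

end
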